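(* Let $A$ be an $m\times n$ real matrix, $b\in\mathbb{R}^m$, and let $X=\{x\in\mathbb{R}^n\mid Ax=b,\ x\geq 0\}$ be nonempty. Let $X^*$ be the set of basic solutions in $X$. Suppose $X$ is bounded. Then $$X=\Big\{\sum_{x^*\in X^*}\alpha_{x^*}x^* \ \Big|\ \alpha_{x^*}\geq 0 \text{ for all } x^*\in X^* \text{ and } \sum_{x^*\in X^*}\alpha_{x^*}=1\Big\},$$ and $X^*$ is the set of extreme points of $X$.
   Context: For a vector $x$, $x\geq 0$ means that every coordinate of $x$ is nonnegative. $A^j$ denotes the $j$-th column of $A$. The set of basic solutions is $X^*=\{x\in X\mid \text{the columns of } A \text{ in the array } \langle A^j\mid x_j>0\rangle \text{ are linearly independent}\}$, where linear independence is that of the family indexed by $\{j\mid x_j>0\}$; if $0\in X$, then $0$ counts as a basic solution. The set $X^*$ is finite. A point $x\in X$ is an extreme point of $X$ if there do not exist distinct $x^{(1)},x^{(2)}\in X$ and $\alpha\in(0,1)$ such that $x=\alpha x^{(1)}+(1-\alpha)x^{(2)}$. *)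

theory Defs
  imports "HOL-Analysis.Analysis"
begin

(* The library's independent is a predicate on sets, under which a repeated vector
   counts only once.  Here independence of the family (v j), j in J, is needed. *)
definition independent_family :: "('i::finite \<Rightarrow> 'v::real_vector) \<Rightarrow> 'i set \<Rightarrow> bool" where
  "independent_family v J \<longleftrightarrow>
     (\<forall>c::'i \<Rightarrow> real. (\<Sum>j\<in>J. c j *\<^sub>R v j) = 0 \<longrightarrow> (\<forall>j\<in>J. c j = 0))"

definition feasible_set :: "real ^ 'n ^ 'm \<Rightarrow> real ^ 'm \<Rightarrow> (real ^ 'n) set" where
  "feasible_set A b = {x. A *v x = b \<and> (\<forall>j. 0 \<le> x $ j)}"

definition basic_solutions :: "real ^ 'n ^ 'm \<Rightarrow> real ^ 'm \<Rightarrow> (real ^ 'n) set" where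
  "basic_solutions A b =
     {x \<in> feasible_set A b. independent_family (\<lambda>j. column j A) {j. x $ j > 0}}"

lemma independent_family_iff:
  "independent_family v J \<longleftrightarrow> inj_on v J \<and> independent (v ` J)"
proof
  assume L: "independent_family v J"
  have inj: "inj_on v J"
  proof (rule inj_onI, rule ccontr)
    fix i j assume ij: "i \<in> J" "j \<in> J" "v i = v j" "i \<noteq> j"
    define c :: "'a \<Rightarrow> real" where "c = (\<lambda>k. if k = i then 1 else if k = j then -1 else 0)"
    have "(\<Sum>k\<in>J. c k *\<^sub>R v k) = (\<Sum>k\<in>{i,j}. c k *\<^sub>R v k)"
      by (rule sum.mono_neutral_right) (use ij in \<open>auto simp: c_def\<close>)
    also have "\<dots> = 0" using ij by (simp add: c_def)
    finally have "c i = 0" using L ij(1) unfolding independent_family_def by blast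
    then show False by (simp add: c_def)
  qed
  have "u w = 0" if "(\<Sum>w\<in>v ` J. u w *\<^sub>R w) = 0" "w \<in> v ` J" for u w
  proof -
    have "(\<Sum>j\<in>J. u (v j) *\<^sub>R v j) = 0"
      using that(1) inj by (simp add: sum.reindex)
    with L have "\<forall>j\<in>J. u (v j) = 0"
      unfolding independent_family_def by (elim allE[of _ "\<lambda>j. u (v j)"]) simp
    with that(2) show ?thesis by auto
  qed
  with inj show "inj_on v J \<and> independent (v ` J)"
    using dependent_finite[of "v ` J"] by auto
next
  assume R: "inj_on v J \<and> independent (v ` J)"
  show "independent_family v J"
    unfolding independent_family_def
  proof (intro allI impI ballI)
    fix c :: "'a \<Rightarrow> real" and j
    assume c: "(\<Sum>j\<in>J. c j *\<^sub>R v j) = 0" and j: "j \<in> J"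
    have "(\<Sum>w\<in>v ` J. c (inv_into J v w) *\<^sub>R w) = 0"
      using R c by (simp add: sum.reindex)
    moreover have "\<not> (\<exists>u. (\<exists>w\<in>v ` J. u w \<noteq> 0) \<and> (\<Sum>w\<in>v ` J. u w *\<^sub>R w) = 0)"
      using R by (subst dependent_finite[symmetric]) auto
    ultimately have "\<forall>w\<in>v ` J. c (inv_into J v w) = 0"
      by meson
    with R j show "c j = 0" by fastforce
  qed
qed

lemma finite_basic_solutions: "finite (basic_solutions A b)"
proof (rule finite_imageD[where f = "\<lambda>x. {j. x $ j > 0}"])
  show "finite ((\<lambda>x. {j. x $ j > 0}) ` basic_solutions A b)" by simp
  show "inj_on (\<lambda>x. {j. x $ j > 0}) (basic_solutions A b)"
  proof (rule inj_onI)
    fix x y assume x: "x \<in> basic_solutions A b" and y: "y \<in> basic_solutions A b"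
      and eq: "{j. x $ j > 0} = {j. y $ j > 0}"
    let ?J = "{j. x $ j > 0}"
    have out: "x $ j = 0 \<and> y $ j = 0" if "j \<notin> ?J" for j
    proof -
      have "\<not> 0 < x $ j" "\<not> 0 < y $ j" using that eq by auto
      moreover have "0 \<le> x $ j" "0 \<le> y $ j"
        using x y by (auto simp: basic_solutions_def feasible_set_def)
      ultimately show ?thesis by simp
    qed
    have "A *v (x - y) = 0"
      using x y by (simp add: basic_solutions_def feasible_set_def matrix_vector_mult_diff_distrib)
    then have "(\<Sum>j\<in>UNIV. (x $ j - y $ j) *\<^sub>R column j A) = 0"
      by (simp add: matrix_mult_sum scalar_mult_eq_scaleR)
    moreover have "(\<Sum>j\<in>UNIV. (x $ j - y $ j) *\<^sub>R column j A)
        = (\<Sum>j\<in>?J. (x $ j - y $ j) *\<^sub>R column j A)"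
      by (rule sum.mono_neutral_right) (use out in auto)
    ultimately have "\<forall>j\<in>?J. x $ j - y $ j = 0"
      using x unfolding basic_solutions_def independent_family_def
      by (auto elim: allE[of _ "\<lambda>j. x $ j - y $ j"])
    with out have "x $ j = y $ j" for j by (cases "j \<in> ?J") auto
    then show "x = y" by (simp add: vec_eq_iff)
  qed
qed

end

theory Submission
  imports Defs
begin

text \<open>
  The basic solutions are exactly the extreme points of the feasible polyhedron, because
  both notions say that \<open>x\<close> cannot be moved along a line inside the
  polyhedron: a direction \<open>d\<close> keeps the equations true iff it lies in the kernel of \<open>A\<close>, and
  small steps \<open>x \<plusminus> \<epsilon> d\<close> stay nonnegative iff \<open>d\<close> vanishes wherever \<open>x\<close> does. So the obstruction to
  extremality is a nonzero kernel vector supported on \<open>{j. x $ j > 0}\<close>, that is, a linear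
  relation among the corresponding columns (\<open>basic_solutions_eq_extreme_points\<close>).

  Boundedness makes the polyhedron a compact convex set, hence by Minkowski's theorem the convex
  hull of its extreme points. As there are finitely many basic solutions, this hull is the set
  of their convex combinations.
\<close>

text \<open>
  A linear relation among the columns indexed by \<open>J\<close>, extended by zero outside \<open>J\<close>, is a kernel
  vector. This trades coefficient families for directions, which can be added to points.
\<close>

lemma independent_columns_iff_kernel:
  fixes A :: "real ^ 'n ^ 'm"
  shows "independent_family (\<lambda>j. column j A) J \<longleftrightarrow>
           (\<forall>d. A *v d = 0 \<longrightarrow> (\<forall>j. j \<notin> J \<longrightarrow> d $ j = 0) \<longrightarrow> d = 0)"
proof -
  have mult: "A *v d = (\<Sum>j\<in>J. (d $ j) *\<^sub>R column j A)" if "\<forall>j. j \<notin> J \<longrightarrow> d $ j = 0" for d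
  proof -
    have "A *v d = (\<Sum>j\<in>UNIV. (d $ j) *\<^sub>R column j A)"
      by (simp add: matrix_mult_sum scalar_mult_eq_scaleR)
    also have "\<dots> = (\<Sum>j\<in>J. (d $ j) *\<^sub>R column j A)"
      by (rule sum.mono_neutral_right) (use that in auto)
    finally show ?thesis .
  qed
  show ?thesis
  proof (intro iffI allI impI)
    fix d
    assume ind: "independent_family (\<lambda>j. column j A) J"
      and d: "A *v d = 0" "\<forall>j. j \<notin> J \<longrightarrow> d $ j = 0"
    have "\<forall>j\<in>J. d $ j = 0"
      using ind mult[OF d(2)] d(1) unfolding independent_family_def by simp
    with d(2) show "d = 0" by (metis vec_eq_iff zero_index)
  next
    assume ker: "\<forall>d. A *v d = 0 \<longrightarrow> (\<forall>j. j \<notin> J \<longrightarrow> d $ j = 0) \<longrightarrow> d = 0"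
    show "independent_family (\<lambda>j. column j A) J"
      unfolding independent_family_def
    proof (intro allI impI ballI)
      fix c :: "'n \<Rightarrow> real" and j
      assume c: "(\<Sum>j\<in>J. c j *\<^sub>R column j A) = 0" and j: "j \<in> J"
      define d :: "real ^ 'n" where "d = (\<chi> j. if j \<in> J then c j else 0)"
      have out: "\<forall>j. j \<notin> J \<longrightarrow> d $ j = 0" by (simp add: d_def)
      have "A *v d = 0" using mult[OF out] c by (simp add: d_def)
      with ker out have "d = 0" by blast
      then have "d $ j = 0" by simp
      with j show "c j = 0" by (simp add: d_def)
    qed
  qed
qed

lemma convex_feasible_set: "convex (feasible_set A b)"
  unfolding convex_def feasible_set_def
  by (auto simp: matrix_vector_right_distrib matrix_vector_mult_scaleR
      simp flip: scaleR_left_distrib)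

lemma closed_feasible_set: "closed (feasible_set A b)"
proof -
  have "closed {x. A *v x = b}"
    by (intro closed_Collect_eq continuous_intros)
  moreover have "closed {x::real^'a. \<forall>j. 0 \<le> x $ j}"
    by (intro closed_Collect_all closed_Collect_le continuous_intros)
  ultimately show ?thesis
    unfolding feasible_set_def by (simp add: Collect_conj_eq closed_Int)
qed

lemma feasible_add_kernel:
  assumes "x \<in> feasible_set A b" "A *v d = 0" "\<And>j. \<bar>d $ j\<bar> \<le> x $ j"
  shows "x + d \<in> feasible_set A b"
  unfolding feasible_set_def
proof safe
  show "A *v (x + d) = b"
    using assms(1,2) by (simp add: feasible_set_def matrix_vector_right_distrib)
  show "0 \<le> (x + d) $ j" for j using assms(3)[of j] by simp
qed

text \<open>
  A coordinate that vanishes at a point inside a segment of nonnegative vectors vanishes at both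
  ends, so the two ends differ from the point by kernel vectors supported on its positive
  coordinates.
\<close>

lemma basic_solution_imp_extreme_point:
  assumes x: "x \<in> basic_solutions A b"
  shows "x extreme_point_of feasible_set A b"
  unfolding extreme_point_of_def
proof (intro conjI ballI notI)
  show xX: "x \<in> feasible_set A b" using x by (simp add: basic_solutions_def)
  fix y z
  assume y: "y \<in> feasible_set A b" and z: "z \<in> feasible_set A b" and seg: "x \<in> open_segment y z"
  from seg obtain u where u: "0 < u" "u < 1" and xeq: "x = (1 - u) *\<^sub>R y + u *\<^sub>R z"
    by (auto simp: in_segment)
  have "x - y = 0"
  proof -
    have "A *v (x - y) = 0"
      using xX y by (simp add: feasible_set_def matrix_vector_mult_diff_distrib)
    moreover have "(x - y) $ j = 0" if "j \<notin> {j. x $ j > 0}" for j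
    proof -
      have nonneg: "0 \<le> x $ j" "0 \<le> y $ j" "0 \<le> z $ j"
        using xX y z by (auto simp: feasible_set_def)
      have "(1 - u) * y $ j + u * z $ j = 0" using that nonneg(1) xeq by simp
      moreover have "0 \<le> (1 - u) * y $ j" "0 \<le> u * z $ j" using u nonneg by simp_all
      ultimately have "(1 - u) * y $ j = 0" by linarith
      with u that nonneg(1) show ?thesis by simp
    qed
    ultimately show ?thesis
      using x unfolding basic_solutions_def independent_columns_iff_kernel by blast
  qed
  with seg show False by (simp add: open_segment_def)
qed

text \<open>
  A nonzero kernel vector supported on the positive coordinates of \<open>x\<close> can be scaled down until
  it is dominated by \<open>x\<close>, which makes \<open>x\<close> the midpoint of two distinct feasible points.
\<close>

lemma extreme_point_imp_basic_solution:
  assumes ext: "x extreme_point_of feasible_set A b"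
  shows "x \<in> basic_solutions A b"
proof -
  have xX: "x \<in> feasible_set A b" using ext by (simp add: extreme_point_of_def)
  let ?J = "{j. x $ j > 0}"
  have "d = 0" if d: "A *v d = 0" and out: "\<forall>j. j \<notin> ?J \<longrightarrow> d $ j = 0" for d
  proof (rule ccontr)
    assume "d \<noteq> 0"
    \<comment> \<open>The element 1 keeps the minimum defined when \<open>x = 0\<close>; the summand 1 in the denominator
        keeps the quotients defined where \<open>d\<close> vanishes.\<close>
    define E where "E = insert 1 ((\<lambda>j. x $ j / (1 + \<bar>d $ j\<bar>)) ` ?J)"
    define \<epsilon> where "\<epsilon> = Min E"
    have finE: "finite E" "E \<noteq> {}" by (simp_all add: E_def)
    have "\<forall>e\<in>E. 0 < e" by (auto simp: E_def intro!: divide_pos_pos)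
    then have pos: "0 < \<epsilon>" using finE by (simp add: \<epsilon>_def)
    have bound: "\<bar>(\<epsilon> *\<^sub>R d) $ j\<bar> \<le> x $ j" for j
    proof (cases "j \<in> ?J")
      case True
      then have "\<epsilon> \<le> x $ j / (1 + \<bar>d $ j\<bar>)" using finE by (auto simp: \<epsilon>_def E_def)
      then have "\<epsilon> * (1 + \<bar>d $ j\<bar>) \<le> x $ j" by (simp add: pos_le_divide_eq)
      with pos show ?thesis by (simp add: abs_mult algebra_simps)
    next
      case False
      with out xX show ?thesis by (simp add: feasible_set_def)
    qed
    have ker: "A *v (\<epsilon> *\<^sub>R d) = 0" using d by (simp add: matrix_vector_mult_scaleR)
    have "x + \<epsilon> *\<^sub>R d \<in> feasible_set A b"
      by (rule feasible_add_kernel[OF xX ker bound])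
    moreover have "x + (- \<epsilon>) *\<^sub>R d \<in> feasible_set A b"
      by (rule feasible_add_kernel[OF xX])
         (use d bound in \<open>simp_all add: matrix_vector_mult_scaleR del: scaleR_minus_left\<close>)
    moreover have "x \<in> open_segment (x + \<epsilon> *\<^sub>R d) (x + (- \<epsilon>) *\<^sub>R d)"
    proof -
      have mid: "midpoint (x + \<epsilon> *\<^sub>R d) (x + (- \<epsilon>) *\<^sub>R d) = x"
        by (simp add: midpoint_def flip: scaleR_2)
      have "x + \<epsilon> *\<^sub>R d \<noteq> x + (- \<epsilon>) *\<^sub>R d"
      proof
        assume "x + \<epsilon> *\<^sub>R d = x + (- \<epsilon>) *\<^sub>R d"
        then have "\<epsilon> = - \<epsilon>" using \<open>d \<noteq> 0\<close> by (simp del: scaleR_minus_left)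
        with pos show False by simp
      qed
      then show ?thesis using midpoint_in_open_segment mid by metis
    qed
    ultimately show False using ext unfolding extreme_point_of_def by blast
  qed
  then show ?thesis
    using xX unfolding basic_solutions_def independent_columns_iff_kernel by blast
qed

lemma basic_solutions_eq_extreme_points:
  "basic_solutions A b = {x. x extreme_point_of (feasible_set A b)}"
  using basic_solution_imp_extreme_point extreme_point_imp_basic_solution by blast

theorem mainTheorem4:
  fixes A :: "real ^ 'n ^ 'm" and b :: "real ^ 'm"
  assumes "feasible_set A b \<noteq> {}"
    and "bounded (feasible_set A b)"
  shows "feasible_set A b =
           {(\<Sum>x\<in>basic_solutions A b. \<alpha> x *\<^sub>R x) | \<alpha> :: real ^ 'n \<Rightarrow> real.
              (\<forall>x\<in>basic_solutions A b. 0 \<le> \<alpha> x) \<and> (\<Sum>x\<in>basic_solutions A b. \<alpha> x) = 1}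
         \<and> basic_solutions A b = {x. x extreme_point_of (feasible_set A b)}"
proof
  show ext: "basic_solutions A b = {x. x extreme_point_of (feasible_set A b)}"
    by (rule basic_solutions_eq_extreme_points)
  have "compact (feasible_set A b)"
    using assms(2) closed_feasible_set by (simp add: compact_eq_bounded_closed)
  then have "feasible_set A b = convex hull (basic_solutions A b)"
    unfolding ext by (rule Krein_Milman_Minkowski[OF _ convex_feasible_set])
  also have "\<dots> = {(\<Sum>x\<in>basic_solutions A b. \<alpha> x *\<^sub>R x) | \<alpha> :: real ^ 'n \<Rightarrow> real.
      (\<forall>x\<in>basic_solutions A b. 0 \<le> \<alpha> x) \<and> (\<Sum>x\<in>basic_solutions A b. \<alpha> x) = 1}"
    unfolding convex_hull_finite[OF finite_basic_solutions] by blast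
  finally show "feasible_set A b = \<dots>" .
qed

end
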